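(* Let $(X,\mathcal T)$ be a nonempty topological space. For each type of space below, and for each $\psi$-number $n$ in the accompanying list, every space of that type contains a subset $A$ with $\psi A=n$: - discrete with $|X|>1$: $68$; - indiscrete partition: $61$; - non-indiscrete partition: $59,60,68$; - EO: $65,67$; - ED: $65,67$; - OU: $62,63,65,67$; - KD: $31,46,48,59,60,62,63,64,66,65,67,68$; - GE: $42,44,62,63,65,67$. Each list is sharp: for each type, and for each local collapse $C$ of $\mathbf{KF}$ that is neither in the list nor one of the two collapses satisfied by the subsets $\varnothing$ and $X$ of a nonempty space, there is a space of that type no subset of which satisfies $C$.
   Context: Set operators on $X\ne\varnothing$ are maps $2^X\to2^X$; products are compositions, $(o_1o_2)A=o_1(o_2A)$. Let $a$ be complement, $b$ closure, $i=aba$ interior, $f$ boundary ($fA=bA\cap b(aA)$), $\mathrm{id}$ the identity operator, $0A=\varnothing$, $1=a0$. Put $\mathbf K^0=\{\mathrm{id},b,i,bi,ib,bib,ibi\}$, $\mathbf F^0=\{0,f,if,fif,bif,ff,fb,fi,fbi,fib\}$, $\mathbf K=\mathbf K^0\cup a\mathbf K^0$, $\mathbf{KF}=(\mathbf K^0\cup\mathbf F^0)\cup a(\mathbf K^0\cup\mathbf F^0)$, sets of 14 and 34 formal words interpreted as operators in each space; $|\mathbf K|,|\mathbf{KF}|$ denote the number of distinct operators they give in the space. Types of spaces. Let $S=\{o\in\{ib,bi,b\}: o=bib \text{ as operators on } 2^X\}$. The space is Kuratowski if $S=\varnothing$ (equivalently $|\mathbf K|=14$), ED if $S=\{ib\}$,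 OU if $S=\{bi\}$, EO if $S=\{ib,bi\}$, partition if $S=\{ib,b\}$, discrete if $S=\{ib,bi,b\}$; these are the only possibilities. A Kuratowski space is KD (Kuratowski disconnected) if $ifA$ is clopen for every $A\subseteq X$ (equivalently $|\mathbf{KF}|=28$), and GE otherwise (equivalently $|\mathbf{KF}|=34$). A collapse of $\mathbf{KF}$ is a set of unordered pairs of words; a subset $A$ satisfies the collapse $C$ if for all distinct words $o_1,o_2\in\mathbf{KF}$, $o_1A=o_2A\iff\{o_1,o_2\}\in C$. A local collapse is one satisfied by some subset of some nonempty space. The collapse generated by a list of equations is given by the smallest equivalence relation on the 34 words containing them and closed under $o=p\Rightarrow ao=ap$ ($aa=\mathrm{id}$). $\psi A=n$ means that $A$ satisfies exactly the collapse numbered $n$, where the relevant ones are generated by: 31: $bib=b$, $ibi=i$, $ff=fb=fib=fi=fbi$, $fif=0$, $bif=if$. 42: $bib=ib=b$, $ibi=i$, $ff=fi=fbi=fif$, $fb=fib=0$, $f=bif$, $b=1$, $i=af$, $bi=aif$. 44: $ibi=bi=i$, $bib=b$, $ff=fb=fib=fif$, $fi=fbi=0$, $f=bif$, $b=f$, $i=0$, $ib=if$. 46: $bib=ib=b$, $ibi=bi$, $fb=fib=fbi=fif=0$, $ff=fi$, $bif=if$, $b=1$, $i=af$, $bi=aif$. 48: $ibi=bi=i$, $bib=ib$, $fi=fib=fbi=fif=0$, $ff=fb$, $bif=if$, $b=f$, $i=0$, $ib=if$. 59: $bib=ib=b$, $ibi=bi=i$, $ff=fb=fi=fib=fbi=fif=0$,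 $f=bif=if$, $b=1$, $i=af$. 60: $bib=ib=b$, $ibi=bi=i$, $ff=fb=fi=fib=fbi=fif=0$, $f=bif=if$, $b=f$, $i=0$. 61: the equations of 60 and $f=1$. 62: $\mathrm{id}=bib=bi=b$, $ibi=ib=i$, $f=ff=fb=fi=fib=fbi$, $bif=fif=if=0$. 63: $bib=bi=b$, $\mathrm{id}=ibi=ib=i$, $f=ff=fb=fi=fib=fbi$, $bif=fif=if=0$. 64: $bib=bi=b=ibi=ib$, $\mathrm{id}=i$, $fb=fib=fbi=0$, $bif=fif=if=0$, $f=ff=fi$. 65: the equations of 64 and $b=1$, $i=af$. 66: $ibi=ib=i=bib=bi$, $\mathrm{id}=b$, $fi=fib=fbi=0$, $bif=fif=if=0$, $f=ff=fb$. 67: the equations of 66 and $b=f$, $i=0$. 68: $\mathrm{id}=bib=bi=b=ibi=ib=i$ and $f=bif=if=ff=fb=fi=fib=fbi=fif=0$. *)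

theory Defs
  imports "HOL-Analysis.Abstract_Topology"
begin

text \<open>Formal words in the letters \<open>a\<close> (complement), \<open>b\<close> (closure), \<open>i\<close> (interior),
  \<open>f\<close> (boundary) and \<open>0\<close>. The word \<open>[x, y, z]\<close> stands for the composition \<open>x \<circ> y \<circ> z\<close>,
  and the empty word for \<open>id\<close>.\<close>

datatype letter = La | Lb | Li | Lf | L0

type_synonym word = "letter list"

text \<open>Points outside the carrier play no role: all operators are only ever applied to subsets
  of \<open>topspace X\<close>.\<close>

primrec letter_op :: "'a topology \<Rightarrow> letter \<Rightarrow> 'a set \<Rightarrow> 'a set" where
  "letter_op X La = (\<lambda>A. topspace X - A)"
| "letter_op X Lb = (\<lambda>A. X closure_of A)"
| "letter_op X Li = (\<lambda>A. X interior_of A)"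
| "letter_op X Lf = (\<lambda>A. X frontier_of A)"
| "letter_op X L0 = (\<lambda>A. {})"

primrec word_op :: "'a topology \<Rightarrow> word \<Rightarrow> 'a set \<Rightarrow> 'a set" where
  "word_op X [] = id"
| "word_op X (l # w) = letter_op X l \<circ> word_op X w"

lemma interior_is_aba:
  "A \<subseteq> topspace X \<Longrightarrow> word_op X [Li] A = word_op X [La, Lb, La] A"
  by (simp add: interior_of_closure_of)

lemma boundary_is_b_inter_ba:
  "A \<subseteq> topspace X \<Longrightarrow> word_op X [Lf] A = word_op X [Lb] A \<inter> word_op X [Lb, La] A"
  by (simp add: frontier_of_closures)

definition same_op :: "'a topology \<Rightarrow> word \<Rightarrow> word \<Rightarrow> bool" where
  "same_op X v w \<longleftrightarrow> (\<forall>A. A \<subseteq> topspace X \<longrightarrow> word_op X v A = word_op X w A)"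

abbreviation wid :: word where "wid \<equiv> []"
abbreviation wb :: word where "wb \<equiv> [Lb]"
abbreviation wi :: word where "wi \<equiv> [Li]"
abbreviation wbi :: word where "wbi \<equiv> [Lb, Li]"
abbreviation wib :: word where "wib \<equiv> [Li, Lb]"
abbreviation wbib :: word where "wbib \<equiv> [Lb, Li, Lb]"
abbreviation wibi :: word where "wibi \<equiv> [Li, Lb, Li]"
abbreviation w0 :: word where "w0 \<equiv> [L0]"
abbreviation wf :: word where "wf \<equiv> [Lf]"
abbreviation wif :: word where "wif \<equiv> [Li, Lf]"
abbreviation wfif :: word where "wfif \<equiv> [Lf, Li, Lf]"
abbreviation wbif :: word where "wbif \<equiv> [Lb, Li, Lf]"
abbreviation wff :: word where "wff \<equiv> [Lf, Lf]"
abbreviation wfb :: word where "wfb \<equiv> [Lf, Lb]"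
abbreviation wfi :: word where "wfi \<equiv> [Lf, Li]"
abbreviation wfbi :: word where "wfbi \<equiv> [Lf, Lb, Li]"
abbreviation wfib :: word where "wfib \<equiv> [Lf, Li, Lb]"
abbreviation w1 :: word where "w1 \<equiv> [La, L0]"
abbreviation waf :: word where "waf \<equiv> [La, Lf]"
abbreviation waif :: word where "waif \<equiv> [La, Li, Lf]"

definition K0 :: "word set" where
  "K0 = {wid, wb, wi, wbi, wib, wbib, wibi}"

definition F0 :: "word set" where
  "F0 = {w0, wf, wif, wfif, wbif, wff, wfb, wfi, wfbi, wfib}"

definition KF :: "word set" where
  "KF = (K0 \<union> F0) \<union> (#) La ` (K0 \<union> F0)"

text \<open>Formal left multiplication by \<open>a\<close>, with \<open>aa = id\<close>; it maps \<open>KF\<close> to itself.\<close>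

fun compl_word :: "word \<Rightarrow> word" where
  "compl_word (La # w) = w"
| "compl_word w = La # w"


subsection \<open>Types of spaces\<close>

definition type_set :: "'a topology \<Rightarrow> word set" where
  "type_set X = {w \<in> {wib, wbi, wb}. same_op X w wbib}"

definition kuratowski_space :: "'a topology \<Rightarrow> bool" where
  "kuratowski_space X \<longleftrightarrow> topspace X \<noteq> {} \<and> type_set X = {}"

definition ED_space :: "'a topology \<Rightarrow> bool" where
  "ED_space X \<longleftrightarrow> topspace X \<noteq> {} \<and> type_set X = {wib}"

definition OU_space :: "'a topology \<Rightarrow> bool" where
  "OU_space X \<longleftrightarrow> topspace X \<noteq> {} \<and> type_set X = {wbi}"

definition EO_space :: "'a topology \<Rightarrow> bool" where
  "EO_space X \<longleftrightarrow> topspace X \<noteq> {} \<and> type_set X = {wib, wbi}"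

definition partition_space :: "'a topology \<Rightarrow> bool" where
  "partition_space X \<longleftrightarrow> topspace X \<noteq> {} \<and> type_set X = {wib, wb}"

definition discrete_space :: "'a topology \<Rightarrow> bool" where
  "discrete_space X \<longleftrightarrow> topspace X \<noteq> {} \<and> type_set X = {wib, wbi, wb}"

definition KD_space :: "'a topology \<Rightarrow> bool" where
  "KD_space X \<longleftrightarrow> kuratowski_space X \<and>
     (\<forall>A. A \<subseteq> topspace X \<longrightarrow> openin X (word_op X wif A) \<and> closedin X (word_op X wif A))"

definition GE_space :: "'a topology \<Rightarrow> bool" where
  "GE_space X \<longleftrightarrow> kuratowski_space X \<and> \<not> KD_space X"

definition indiscrete :: "'a topology \<Rightarrow> bool" where
  "indiscrete X \<longleftrightarrow> (\<forall>U. openin X U \<longleftrightarrow> U = {} \<or> U = topspace X)"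

datatype space_type =
  Discrete_gt1 | Indiscrete_partition | Nonindiscrete_partition | EO | ED | OU | KD | GE

primrec has_type :: "'a topology \<Rightarrow> space_type \<Rightarrow> bool" where
  "has_type X Discrete_gt1 \<longleftrightarrow>
     discrete_space X \<and> (\<exists>x \<in> topspace X. \<exists>y \<in> topspace X. x \<noteq> y)"
| "has_type X Indiscrete_partition \<longleftrightarrow> partition_space X \<and> indiscrete X"
| "has_type X Nonindiscrete_partition \<longleftrightarrow> partition_space X \<and> \<not> indiscrete X"
| "has_type X EO \<longleftrightarrow> EO_space X"
| "has_type X ED \<longleftrightarrow> ED_space X"
| "has_type X OU \<longleftrightarrow> OU_space X"
| "has_type X KD \<longleftrightarrow> KD_space X"
| "has_type X GE \<longleftrightarrow> GE_space X"

primrec psi_list :: "space_type \<Rightarrow> nat set" where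
  "psi_list Discrete_gt1 = {68}"
| "psi_list Indiscrete_partition = {61}"
| "psi_list Nonindiscrete_partition = {59, 60, 68}"
| "psi_list EO = {65, 67}"
| "psi_list ED = {65, 67}"
| "psi_list OU = {62, 63, 65, 67}"
| "psi_list KD = {31, 46, 48, 59, 60, 62, 63, 64, 66, 65, 67, 68}"
| "psi_list GE = {42, 44, 62, 63, 65, 67}"


subsection \<open>Collapses\<close>

text \<open>An unordered pair consists of two different words: a singleton \<open>{w}\<close> would be
  invisible to \<open>satisfies\<close>, and collapses would not be determined by the sets satisfying them.\<close>

type_synonym collapse = "word set set"

definition is_collapse :: "collapse \<Rightarrow> bool" where
  "is_collapse C \<longleftrightarrow> C \<subseteq> {{v, w} | v w. v \<in> KF \<and> w \<in> KF \<and> v \<noteq> w}"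

definition satisfies :: "'a topology \<Rightarrow> 'a set \<Rightarrow> collapse \<Rightarrow> bool" where
  "satisfies X A C \<longleftrightarrow>
     (\<forall>v \<in> KF. \<forall>w \<in> KF. v \<noteq> w \<longrightarrow> (word_op X v A = word_op X w A \<longleftrightarrow> {v, w} \<in> C))"

text \<open>HOL cannot quantify over types inside a formula, so the type carrying the spaces is a
  parameter of the next two notions.\<close>

definition local_collapse :: "'a itself \<Rightarrow> collapse \<Rightarrow> bool" where
  "local_collapse _ C \<longleftrightarrow> is_collapse C \<and>
     (\<exists>(X :: 'a topology) A. topspace X \<noteq> {} \<and> A \<subseteq> topspace X \<and> satisfies X A C)"

definition trivial_collapse :: "'a itself \<Rightarrow> collapse \<Rightarrow> bool" where
  "trivial_collapse _ C \<longleftrightarrow> is_collapse C \<and>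
     (\<exists>X :: 'a topology. topspace X \<noteq> {} \<and> (satisfies X {} C \<or> satisfies X (topspace X) C))"

text \<open>A system of equations is a list of chains; the chain \<open>[u, v, w]\<close> stands for \<open>u = v = w\<close>.\<close>

inductive gen_equiv :: "word list list \<Rightarrow> word \<Rightarrow> word \<Rightarrow> bool" for E where
  gen_base: "c \<in> set E \<Longrightarrow> v \<in> set c \<Longrightarrow> w \<in> set c \<Longrightarrow> gen_equiv E v w"
| gen_refl: "v \<in> KF \<Longrightarrow> gen_equiv E v v"
| gen_sym: "gen_equiv E v w \<Longrightarrow> gen_equiv E w v"
| gen_trans: "gen_equiv E u v \<Longrightarrow> gen_equiv E v w \<Longrightarrow> gen_equiv E u w"
| gen_compl: "gen_equiv E v w \<Longrightarrow> gen_equiv E (compl_word v) (compl_word w)"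

definition generated_collapse :: "word list list \<Rightarrow> collapse" where
  "generated_collapse E = {{v, w} | v w. gen_equiv E v w \<and> v \<noteq> w}"

definition eqs60 :: "word list list" where
  "eqs60 = [[wbib, wib, wb], [wibi, wbi, wi], [wff, wfb, wfi, wfib, wfbi, wfif, w0],
            [wf, wbif, wif], [wb, wf], [wi, w0]]"

definition eqs64 :: "word list list" where
  "eqs64 = [[wbib, wbi, wb, wibi, wib], [wid, wi], [wfb, wfib, wfbi, w0],
            [wbif, wfif, wif, w0], [wf, wff, wfi]]"

definition eqs66 :: "word list list" where
  "eqs66 = [[wibi, wib, wi, wbib, wbi], [wid, wb], [wfi, wfib, wfbi, w0],
            [wbif, wfif, wif, w0], [wf, wff, wfb]]"

text \<open>Only the values at the numbers occurring in the table are meaningful.\<close>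

definition equations :: "nat \<Rightarrow> word list list" where
  "equations n = the (map_of
    [(31, [[wbib, wb], [wibi, wi], [wff, wfb, wfib, wfi, wfbi], [wfif, w0], [wbif, wif]]),
     (42, [[wbib, wib, wb], [wibi, wi], [wff, wfi, wfbi, wfif], [wfb, wfib, w0], [wf, wbif],
           [wb, w1], [wi, waf], [wbi, waif]]),
     (44, [[wibi, wbi, wi], [wbib, wb], [wff, wfb, wfib, wfif], [wfi, wfbi, w0], [wf, wbif],
           [wb, wf], [wi, w0], [wib, wif]]),
     (46, [[wbib, wib, wb], [wibi, wbi], [wfb, wfib, wfbi, wfif, w0], [wff, wfi], [wbif, wif],
           [wb, w1], [wi, waf], [wbi, waif]]),
     (48, [[wibi, wbi, wi], [wbib, wib], [wfi, wfib, wfbi, wfif, w0], [wff, wfb], [wbif, wif],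
           [wb, wf], [wi, w0], [wib, wif]]),
     (59, [[wbib, wib, wb], [wibi, wbi, wi], [wff, wfb, wfi, wfib, wfbi, wfif, w0],
           [wf, wbif, wif], [wb, w1], [wi, waf]]),
     (60, eqs60),
     (61, eqs60 @ [[wf, w1]]),
     (62, [[wid, wbib, wbi, wb], [wibi, wib, wi], [wf, wff, wfb, wfi, wfib, wfbi],
           [wbif, wfif, wif, w0]]),
     (63, [[wbib, wbi, wb], [wid, wibi, wib, wi], [wf, wff, wfb, wfi, wfib, wfbi],
           [wbif, wfif, wif, w0]]),
     (64, eqs64),
     (65, eqs64 @ [[wb, w1], [wi, waf]]),
     (66, eqs66),
     (67, eqs66 @ [[wb, wf], [wi, w0]]),
     (68, [[wid, wbib, wbi, wb, wibi, wib, wi],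
           [wf, wbif, wif, wff, wfb, wfi, wfib, wfbi, wfif, w0]])] n)"

definition numbered_collapse :: "nat \<Rightarrow> collapse" where
  "numbered_collapse n = generated_collapse (equations n)"

text \<open>\<open>has_psi X A n\<close> is \<open>\<psi>A = n\<close>.\<close>

definition has_psi :: "'a topology \<Rightarrow> 'a set \<Rightarrow> nat \<Rightarrow> bool" where
  "has_psi X A n \<longleftrightarrow> satisfies X A (numbered_collapse n)"

end

theory Submission
  imports Defs
begin

text \<open>An open continuous map \<open>q\<close> of \<open>X\<close> onto a space \<open>Y\<close> satisfies \<open>q\<inverse>(b B) = b(q\<inverse> B)\<close>, hence
\<open>q\<inverse>(o B) = o(q\<inverse> B)\<close> for every word \<open>o\<close>. As \<open>q\<close> is onto, \<open>q\<inverse> B\<close> satisfies the same collapse as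
\<open>B\<close>. So every collapse that occurs in \<open>Y\<close> occurs in \<open>X\<close>. The theorem holds because each type of
spaces has one finite \<^emph>\<open>model\<close>, with at most five points, onto which every space of that type has
such a map (\<open>model_decomposition\<close>), and because the subsets of the models have exactly the
listed \<open>\<psi>\<close>-numbers, apart from \<open>\<emptyset>\<close> and the whole model (\<open>table_correct_psi_table\<close>).

The topological content is the construction of the maps. Points are separated by two phenomena.
If \<open>U\<close> is regular open and not closed, then \<open>U\<close>, its exterior and \<open>bU - U\<close> are the cells of a
quotient; for an open set \<open>U\<close> that is merely not closed, the first two have to be united. Secondly,
if \<open>R\<close> is open and contained in \<open>fA\<close>, then \<open>R \<inter> A\<close> and \<open>R - A\<close> are both dense in
\<open>R\<close>, and become two topologically indistinguishable points. A space with
\<open>ib \<noteq> bib\<close> contains a regular open set that is not closed, a space with \<open>bi \<noteq> bib\<close> contains a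
nonempty set \<open>ifA\<close>, and whether the sets \<open>ifA\<close> are clopen is the difference between KD and GE.

For sharpness the model itself has the required type, so it admits no collapse beyond its table.
The only exception is ED: the model, Sierpinski space, is EO. There two finite ED spaces are
needed, whose sets of \<open>\<psi>\<close>-numbers have the intersection \<open>{65, 67}\<close>: the first realises only
\<open>61, 65, 67\<close>, and the second has an isolated clopen point, which excludes \<open>61\<close>.

That a subset of a model satisfies a generated collapse is checked by computation. Words that the
generating equations identify have equal values; conversely, a list of representatives, to which the
equations reduce every word up to complement, takes, together with the complements, pairwise distinct values (\<open>collapse_test_sound\<close>).\<close>

section \<open>Open decompositions and the action of words on their regions\<close>

text \<open>A finite space with points \<open>0, 1, \<dots>\<close> is given by the list \<open>N\<close> of the smallest neighbourhoods
of its points, and a subset by the list of the truth values of membership, so that equality of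
subsets can be decided by evaluation.\<close>
primrec model_letter :: "nat list list \<Rightarrow> letter \<Rightarrow> bool list \<Rightarrow> bool list" where
  "model_letter N La bs = map Not bs"
| "model_letter N Lb bs = map (list_ex (\<lambda>r. bs ! r)) N"
| "model_letter N Li bs = map (list_all (\<lambda>r. bs ! r)) N"
| "model_letter N Lf bs = map (\<lambda>U. list_ex (\<lambda>r. bs ! r) U \<and> list_ex (\<lambda>r. \<not> bs ! r) U) N"
| "model_letter N L0 bs = map (\<lambda>_. False) N"

primrec model_word :: "nat list list \<Rightarrow> word \<Rightarrow> bool list \<Rightarrow> bool list" where
  "model_word N [] bs = bs"
| "model_word N (l # w) bs = model_letter N l (model_word N w bs)"

lemma length_model_word: "length bs = length N \<Longrightarrow> length (model_word N w bs) = length N"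
proof (induction w)
  case (Cons l w)
  then show ?case by (cases l) simp_all
qed simp

text \<open>The list \<open>Fs\<close> consists of the fibres of an open continuous map from \<open>X\<close> onto the finite space
\<open>N\<close>. Continuity is \<open>open_star\<close>: the preimage of each smallest neighbourhood is open. Openness is
\<open>adherent\<close>: every neighbourhood of a point of the fibre over \<open>p\<close> meets all fibres over the
smallest neighbourhood of \<open>p\<close>.\<close>
locale open_decomposition =
  fixes X :: "'a topology" and N :: "nat list list" and Fs :: "'a set list"
  assumes length_cells: "length Fs = length N"
    and cover: "(\<Union>p<length N. Fs ! p) = topspace X"
    and nonempty: "p < length N \<Longrightarrow> Fs ! p \<noteq> {}"
    and disjoint: "p < length N \<Longrightarrow> q < length N \<Longrightarrow> p \<noteq> q \<Longrightarrow> Fs ! p \<inter> Fs ! q = {}"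
    and bounded: "p < length N \<Longrightarrow> r \<in> set (N ! p) \<Longrightarrow> r < length N"
    and reflexive: "p < length N \<Longrightarrow> p \<in> set (N ! p)"
    and open_star: "p < length N \<Longrightarrow> openin X (\<Union>r\<in>set (N ! p). Fs ! r)"
    and adherent: "p < length N \<Longrightarrow> r \<in> set (N ! p) \<Longrightarrow> Fs ! p \<subseteq> X closure_of (Fs ! r)"
begin

definition region :: "bool list \<Rightarrow> 'a set" where
  "region bs = (\<Union>p\<in>{p. p < length N \<and> bs ! p}. Fs ! p)"

lemma region_subset: "region bs \<subseteq> topspace X"
  unfolding region_def using cover by blast

lemma mem_region: "p < length N \<Longrightarrow> x \<in> Fs ! p \<Longrightarrow> x \<in> region bs \<longleftrightarrow> bs ! p"
  unfolding region_def using disjoint by fastforce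

lemma region_eqI:
  assumes "S \<subseteq> topspace X"
    and "\<And>p x. p < length N \<Longrightarrow> x \<in> Fs ! p \<Longrightarrow> x \<in> S \<longleftrightarrow> bs ! p"
  shows "S = region bs"
proof (rule set_eqI)
  fix x
  show "x \<in> S \<longleftrightarrow> x \<in> region bs"
  proof (cases "x \<in> topspace X")
    case True
    then obtain p where p: "p < length N" "x \<in> Fs ! p" using cover by blast
    show ?thesis using assms(2)[OF p] mem_region[OF p] by simp
  next
    case False
    then show ?thesis using assms(1) region_subset by blast
  qed
qed

lemma region_inject:
  assumes "length bs = length N" "length cs = length N" "region bs = region cs"
  shows "bs = cs"
proof (rule nth_equalityI)
  fix p assume "p < length bs"
  then have p: "p < length N" using assms by simp
  then obtain x where "x \<in> Fs ! p" using nonempty by blast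
  then show "bs ! p = cs ! p" using mem_region[OF p] assms(3) by blast
qed (use assms in simp)

text \<open>From left to right this uses that the star of the cell is an open neighbourhood of \<open>x\<close>
(continuity of the quotient map), from right to left that the cell adheres to every cell in its
star (openness).\<close>
lemma mem_closure_region:
  assumes p: "p < length N" and x: "x \<in> Fs ! p"
  shows "x \<in> X closure_of region bs \<longleftrightarrow> (\<exists>r\<in>set (N ! p). bs ! r)"
proof
  assume "x \<in> X closure_of region bs"
  moreover have "x \<in> (\<Union>r\<in>set (N ! p). Fs ! r)" using reflexive[OF p] x by blast
  ultimately obtain y r where "y \<in> region bs" "r \<in> set (N ! p)" "y \<in> Fs ! r"
    using open_star[OF p] unfolding in_closure_of by blast
  then show "\<exists>r\<in>set (N ! p). bs ! r" using mem_region[of r y bs] bounded[OF p] by blast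
next
  assume "\<exists>r\<in>set (N ! p). bs ! r"
  then obtain r where r: "r \<in> set (N ! p)" "bs ! r" by blast
  then have "Fs ! r \<subseteq> region bs" unfolding region_def using bounded[OF p] by blast
  then show "x \<in> X closure_of region bs"
    using adherent[OF p r(1)] x closure_of_mono by blast
qed

lemma complement_region:
  assumes "length bs = length N"
  shows "topspace X - region bs = region (map Not bs)"
proof (rule region_eqI)
  fix p x assume p: "p < length N" "x \<in> Fs ! p"
  then have "x \<in> topspace X" using cover by blast
  then show "x \<in> topspace X - region bs \<longleftrightarrow> map Not bs ! p"
    using mem_region[OF p] p assms by simp
qed blast

lemma mem_interior_region:
  assumes "length bs = length N" and p: "p < length N" "x \<in> Fs ! p"
  shows "x \<in> X interior_of region bs \<longleftrightarrow> (\<forall>r\<in>set (N ! p). bs ! r)"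
proof -
  have "x \<in> topspace X" using p cover by blast
  then show ?thesis
    using mem_closure_region[OF p, of "map Not bs"] bounded[OF p(1)] assms(1)
    by (auto simp: interior_of_closure_of complement_region)
qed

lemma letter_op_region:
  assumes len: "length bs = length N"
  shows "letter_op X l (region bs) = region (model_letter N l bs)"
proof (cases l)
  case La
  then show ?thesis using complement_region[OF len] by simp
next
  case L0
  then show ?thesis by (auto simp: region_def)
next
  case Lb
  have "X closure_of region bs = region (model_letter N Lb bs)"
    by (rule region_eqI) (simp_all add: closure_of_subset_topspace mem_closure_region list_ex_iff)
  then show ?thesis using Lb by simp
next
  case Li
  have "X interior_of region bs = region (model_letter N Li bs)"
    by (rule region_eqI)
      (simp_all add: interior_of_subset_topspace mem_interior_region[OF len] list_all_iff)
  then show ?thesis using Li by simp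
next
  case Lf
  have "X frontier_of region bs = region (model_letter N Lf bs)"
    by (rule region_eqI)
      (auto simp add: frontier_of_def closure_of_subset_topspace mem_closure_region
        mem_interior_region[OF len] list_ex_iff dest: in_closure_of[THEN iffD1])
  then show ?thesis using Lf by simp
qed

lemma word_op_region:
  assumes "length bs = length N"
  shows "word_op X w (region bs) = region (model_word N w bs)"
  by (induction w) (simp_all add: letter_op_region length_model_word assms)

lemma word_op_region_eq_iff:
  assumes "length bs = length N"
  shows "word_op X v (region bs) = word_op X w (region bs) \<longleftrightarrow> model_word N v bs = model_word N w bs"
  using region_inject[of "model_word N v bs" "model_word N w bs"]
  by (auto simp: word_op_region assms length_model_word)

lemma satisfies_region_iff:
  assumes "length bs = length N"
  shows "satisfies X (region bs) C \<longleftrightarrow>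
    (\<forall>v\<in>KF. \<forall>w\<in>KF. v \<noteq> w \<longrightarrow> (model_word N v bs = model_word N w bs \<longleftrightarrow> {v, w} \<in> C))"
  unfolding satisfies_def by (simp add: word_op_region_eq_iff assms)

end

text \<open>Transitivity says that each \<open>N ! p\<close> is open in the finite space given by \<open>N\<close>.\<close>
definition is_preorder :: "nat list list \<Rightarrow> bool" where
  "is_preorder N \<longleftrightarrow> (\<forall>p\<in>set [0..<length N]. p \<in> set (N ! p) \<and>
     (\<forall>q\<in>set (N ! p). q < length N \<and> set (N ! q) \<subseteq> set (N ! p)))"

lemma open_decompositionI:
  assumes N: "is_preorder N" and len: "length Fs = length N"
    and cover: "\<Union> (set Fs) = topspace X" and ne: "{} \<notin> set Fs"
    and disj: "sorted_wrt (\<lambda>A B. A \<inter> B = {}) Fs"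
    and star: "list_all (\<lambda>U. openin X (\<Union>r\<in>set U. Fs ! r)) N"
    and adh: "list_all2 (\<lambda>F U. \<forall>r\<in>set U. F \<subseteq> X closure_of (Fs ! r)) Fs N"
  shows "open_decomposition X N Fs"
proof
  show "(\<Union>p<length N. Fs ! p) = topspace X"
    using cover by (metis atLeast0LessThan len map_nth set_map set_upt)
  fix p assume p: "p < length N"
  show "Fs ! p \<noteq> {}" using ne p len by (metis nth_mem)
  show "p \<in> set (N ! p)" using N p by (simp add: is_preorder_def)
  show "openin X (\<Union>r\<in>set (N ! p). Fs ! r)" using star p by (simp add: list_all_length)
  fix q
  show "Fs ! p \<inter> Fs ! q = {}" if "q < length N" "p \<noteq> q"
    using sorted_wrt_nth_less[OF disj, of p q] sorted_wrt_nth_less[OF disj, of q p] p that len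
    by (cases "p < q") auto
  show "q < length N" if "q \<in> set (N ! p)" using N p that by (simp add: is_preorder_def)
  show "Fs ! p \<subseteq> X closure_of (Fs ! q)" if "q \<in> set (N ! p)"
    using adh p that len by (simp add: list_all2_conv_all_nth)
qed (rule len)

lemma one_cell_decomposition:
  assumes "topspace X \<noteq> {}"
  shows "open_decomposition X [[0]] [topspace X]"
  by unfold_locales (use assms in \<open>simp_all add: closure_of_topspace lessThan_Suc\<close>)

text \<open>Both spaces map onto the one-point space, whose only subsets are \<open>\<emptyset>\<close> and the whole space.\<close>
lemma trivial_collapse_independent:
  fixes X :: "'a topology" and Y :: "'b topology"
  assumes "topspace X \<noteq> {}" "topspace Y \<noteq> {}"
  shows "satisfies X {} C \<longleftrightarrow> satisfies Y {} C"
    and "satisfies X (topspace X) C \<longleftrightarrow> satisfies Y (topspace Y) C"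
proof -
  interpret X: open_decomposition X "[[0]]" "[topspace X]"
    by (rule one_cell_decomposition[OF assms(1)])
  interpret Y: open_decomposition Y "[[0]]" "[topspace Y]"
    by (rule one_cell_decomposition[OF assms(2)])
  have X: "X.region [False] = {}" "X.region [True] = topspace X"
    and Y: "Y.region [False] = {}" "Y.region [True] = topspace Y"
    by (auto simp: X.region_def Y.region_def)
  show "satisfies X {} C \<longleftrightarrow> satisfies Y {} C"
    using X.satisfies_region_iff[of "[False]" C] Y.satisfies_region_iff[of "[False]" C]
    by (simp add: X Y)
  show "satisfies X (topspace X) C \<longleftrightarrow> satisfies Y (topspace Y) C"
    using X.satisfies_region_iff[of "[True]" C] Y.satisfies_region_iff[of "[True]" C]
    by (simp add: X Y)
qed

section \<open>Deciding whether a subset of a finite space has a given psi-number\<close>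

definition base_words :: "word list" where
  "base_words = [wid, wb, wi, wbi, wib, wbib, wibi, w0, wf, wif, wfif, wbif, wff, wfb, wfi, wfbi, wfib]"

lemma KF_base_words: "KF = set base_words \<union> (#) La ` set base_words"
  by (auto simp: KF_def K0_def F0_def base_words_def)

lemma compl_word_base: "v \<in> set base_words \<Longrightarrow> compl_word v = La # v"
  by (auto simp: base_words_def)

lemma compl_word_in_KF: "v \<in> KF \<Longrightarrow> compl_word v \<in> KF"
  unfolding KF_base_words by (auto simp: compl_word_base)

definition psi_numbers :: "nat set" where
  "psi_numbers = {31, 42, 44, 46, 48, 59, 60, 61, 62, 63, 64, 65, 66, 67, 68}"

text \<open>One base word for each class of the collapse with number \<open>n\<close>, where a class and its complementary
class count as one.\<close>
definition representatives :: "nat \<Rightarrow> word list" where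
  "representatives n = the (map_of
    [(31, [w0, wid, wb, wi, wbi, wib, wf, wff, wif]),
     (42, [w0, wid, wi, wbi, wff]), (44, [w0, wid, wb, wib, wff]),
     (46, [w0, wid, wi, wbi, wff]), (48, [w0, wid, wb, wib, wff]),
     (59, [w0, wid, wf]), (60, [w0, wid, wf]), (61, [w0, wid]),
     (62, [w0, wid, wi, wf]), (63, [w0, wid, wb, wf]),
     (64, [w0, wid, wb, wf]), (65, [w0, wid]),
     (66, [w0, wid, wi, wf]), (67, [w0, wid]), (68, [w0, wid])] n)"

text \<open>The equations connect every word with a representative. For an arbitrary predicate that is
constant along the equations, this is a statement of propositional logic about the values of the
predicate at the base words.\<close>
lemma representatives_span:
  fixes P :: "word \<Rightarrow> bool"
  assumes n: "n \<in> psi_numbers"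
    and compl: "\<And>v. v \<in> set base_words \<Longrightarrow> P (La # v) = P v"
    and chain: "\<And>c v. c \<in> set (equations n) \<Longrightarrow> v \<in> set c \<Longrightarrow> P v = P (hd c)"
    and reps: "\<And>v. v \<in> set (representatives n) \<Longrightarrow> P v"
    and v: "v \<in> set base_words"
  shows "P v"
proof -
  \<comment> \<open>The premises as finite conjunctions, so that unfolding the equations leaves no quantifiers.\<close>
  have compl': "list_all (\<lambda>v. P (La # v) = P v) base_words"
    and chain': "list_all (\<lambda>c. list_all (\<lambda>v. P v = P (hd c)) c) (equations n)"
    and reps': "list_all P (representatives n)"
    using compl chain reps by (simp_all add: list_all_iff)
  note defs = equations_def eqs60_def eqs64_def eqs66_def representatives_def base_words_def
  consider "n = 31" | "n = 42" | "n = 44" | "n = 46" | "n = 48" | "n = 59" | "n = 60" | "n = 61"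
    | "n = 62" | "n = 63" | "n = 64" | "n = 65" | "n = 66" | "n = 67" | "n = 68"
    using n unfolding psi_numbers_def by blast
  then have "list_all P base_words"
    by cases (insert compl' chain' reps',
        ((simp add: defs; fail) | (simp add: defs, argo))+)
  then show ?thesis using v by (simp add: list_all_iff)
qed

lemma equations_in_KF:
  "\<forall>n\<in>psi_numbers. list_all (list_all (\<lambda>v. v \<in> KF)) (equations n)"
  by (simp add: psi_numbers_def equations_def eqs60_def eqs64_def eqs66_def KF_def K0_def F0_def)

lemma gen_equiv_in_KF:
  assumes "\<And>c. c \<in> set E \<Longrightarrow> set c \<subseteq> KF"
  shows "gen_equiv E v w \<Longrightarrow> v \<in> KF \<and> w \<in> KF"
  by (induction rule: gen_equiv.induct) (use assms compl_word_in_KF in auto)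

lemma numbered_is_collapse:
  assumes "n \<in> psi_numbers"
  shows "is_collapse (numbered_collapse n)"
proof -
  have "set c \<subseteq> KF" if "c \<in> set (equations n)" for c
    using assms equations_in_KF that by (auto simp: list_all_iff)
  then show ?thesis
    unfolding is_collapse_def numbered_collapse_def generated_collapse_def
    using gen_equiv_in_KF[of "equations n"] by blast
qed

lemma satisfied_collapse_unique:
  assumes "is_collapse C" "is_collapse D" "satisfies X A C" "satisfies X A D"
  shows "C = D"
proof (rule set_eqI)
  fix e
  show "e \<in> C \<longleftrightarrow> e \<in> D"
    using assms unfolding is_collapse_def satisfies_def by (smt (verit) mem_Collect_eq subset_iff)
qed

lemma generated_collapse_iff:
  "v \<noteq> w \<Longrightarrow> {v, w} \<in> generated_collapse E \<longleftrightarrow> gen_equiv E v w"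
  unfolding generated_collapse_def by (auto simp: doubleton_eq_iff intro: gen_sym)

definition collapse_test :: "nat list list \<Rightarrow> nat \<Rightarrow> bool list \<Rightarrow> bool" where
  "collapse_test N n bs \<longleftrightarrow>
     (\<forall>c\<in>set (equations n). \<forall>v\<in>set c. model_word N v bs = model_word N (hd c) bs) \<and>
     distinct (map (\<lambda>w. model_word N w bs) (representatives n @ map ((#) La) (representatives n)))"

lemma representatives_base: "\<forall>n\<in>psi_numbers. list_all (\<lambda>w. w \<in> set base_words) (representatives n)"
  by (simp add: psi_numbers_def representatives_def base_words_def)

text \<open>Equality of values is an equivalence relation compatible with complements, so it contains the
generated one as soon as it contains the equations. Conversely, equal values of two words pass to
the representatives of their classes, and these are equal because \<open>collapse_test\<close> requires different
representatives to have different values.\<close>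
lemma collapse_test_sound:
  assumes n: "n \<in> psi_numbers" and test: "collapse_test N n bs" and "v \<in> KF" "w \<in> KF"
  shows "model_word N v bs = model_word N w bs \<longleftrightarrow> gen_equiv (equations n) v w"
proof
  let ?E = "equations n" and ?val = "\<lambda>w. model_word N w bs"
  let ?R = "set (representatives n)"
  have compl: "?val (compl_word v) = map Not (?val v)" for v
    by (cases v rule: compl_word.cases) (simp_all add: comp_def)
  have respects: "gen_equiv ?E a b \<Longrightarrow> ?val a = ?val b" for a b
  proof (induction rule: gen_equiv.induct)
    case (gen_base c v w)
    then show ?case using test unfolding collapse_test_def by metis
  qed (simp_all add: compl)
  then show "?val v = ?val w" if "gen_equiv ?E v w"
    using that .
  define P where "P v \<longleftrightarrow> (\<exists>r \<in> ?R \<union> (#) La ` ?R. gen_equiv ?E v r)" for v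
  have R: "r \<in> set base_words" if "r \<in> ?R" for r
    using representatives_base n that by (auto simp: list_all_iff)
  have compl_rep: "compl_word r \<in> ?R \<union> (#) La ` ?R" if "r \<in> ?R \<union> (#) La ` ?R" for r
    using that R by (auto simp: compl_word_base)
  have "P (compl_word v)" if "P v" for v
    using that compl_rep gen_compl[of ?E] unfolding P_def by blast
  then have P_compl: "P (La # v) = P v" if "v \<in> set base_words" for v
    using compl_word_base[OF that] compl_word.simps(1) by metis
  have "P v" if "v \<in> set base_words" for v
  proof (rule representatives_span[OF n _ _ _ that])
    fix c v assume c: "c \<in> set ?E" "v \<in> set c"
    then have "hd c \<in> set c" by (metis hd_in_set list.set(1) empty_iff)
    with c have "gen_equiv ?E v (hd c)" by (rule gen_base)
    then show "P v = P (hd c)" unfolding P_def by (meson gen_sym gen_trans)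
  next
    fix v assume "v \<in> ?R"
    then show "P v" unfolding P_def using R KF_base_words by (blast intro: gen_refl)
  qed (rule P_compl)
  then have P: "P v" if "v \<in> KF" for v
    using that P_compl unfolding KF_base_words by auto
  assume eq: "?val v = ?val w"
  obtain r s where r: "r \<in> ?R \<union> (#) La ` ?R" "gen_equiv ?E v r"
    and s: "s \<in> ?R \<union> (#) La ` ?R" "gen_equiv ?E w s"
    using P[OF \<open>v \<in> KF\<close>] P[OF \<open>w \<in> KF\<close>] unfolding P_def by blast
  have "?val r = ?val s" using r s eq respects by metis
  moreover have "inj_on ?val (?R \<union> (#) La ` ?R)"
    using test unfolding collapse_test_def distinct_map by simp
  ultimately have "r = s" using r s by (auto dest: inj_onD)
  then show "gen_equiv ?E v w" using r s by (meson gen_sym gen_trans)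
qed

lemma (in open_decomposition) region_has_psi:
  assumes "n \<in> psi_numbers" "collapse_test N n bs" "length bs = length N"
  shows "has_psi X (region bs) n"
  unfolding has_psi_def numbered_collapse_def satisfies_region_iff[OF assms(3)]
  using collapse_test_sound[OF assms(1,2)] by (simp add: generated_collapse_iff)

section \<open>Regular open sets and resolvable parts\<close>

text \<open>This is the source of indistinguishable pairs of points in the models: an open part of the
frontier of \<open>A\<close> is cut by \<open>A\<close> into two dense pieces.\<close>

lemma frontier_parts_dense:
  assumes "openin X U" "U \<subseteq> X frontier_of A"
  shows "U \<subseteq> X closure_of (U \<inter> A)" "U \<subseteq> X closure_of (U - A)"
proof -
  have sub: "U \<subseteq> topspace X" using assms(1) openin_subset by blast
  have "U \<subseteq> U \<inter> X closure_of A" "U \<subseteq> U \<inter> X closure_of (topspace X - A)"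
    using assms(2) unfolding frontier_of_closures by auto
  moreover have "U \<inter> (topspace X - A) = U - A" using sub by blast
  ultimately show "U \<subseteq> X closure_of (U \<inter> A)" "U \<subseteq> X closure_of (U - A)"
    using openin_Int_closure_of_subset[OF assms(1)] by (blast, metis subset_trans)
qed

lemma boundary_nonempty:
  assumes "openin X U" "\<not> closedin X U"
  shows "X closure_of U - U \<noteq> {}"
  using assms closure_of_eq[of X U] closure_of_subset[OF openin_subset[OF assms(1)]] by blast

lemma regular_open_not_dense:
  assumes "X interior_of (X closure_of U) = U" "\<not> closedin X U"
  shows "X closure_of U \<noteq> topspace X"
  using assms by (metis closedin_topspace interior_of_topspace)

text \<open>For a regular open set, the frontier of the set is also the frontier of its exterior.\<close>
lemma closure_exterior_regular:
  assumes "X interior_of (X closure_of U) = U"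
  shows "X closure_of (topspace X - X closure_of U) = topspace X - U"
  using assms by (simp add: closure_of_complement)

text \<open>The open set \<open>ibA - biA\<close> lies in \<open>fA\<close>. If it is empty, then \<open>ibA \<subseteq> biA\<close>, hence
\<open>bibA \<subseteq> biA\<close>.\<close>
lemma exists_interior_frontier_nonempty:
  assumes "\<not> same_op X wbi wbib"
  obtains A where "A \<subseteq> topspace X" "X interior_of (X frontier_of A) \<noteq> {}"
proof -
  from assms obtain A where A: "A \<subseteq> topspace X"
    "X closure_of (X interior_of A) \<noteq> X closure_of (X interior_of (X closure_of A))"
    by (auto simp: same_op_def)
  have "X closure_of (X interior_of A) \<subseteq> X closure_of (X interior_of (X closure_of A))"
    by (intro closure_of_mono interior_of_mono closure_of_subset A)
  with A(2) have "\<not> X interior_of (X closure_of A) \<subseteq> X closure_of (X interior_of A)"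
    by (meson closedin_closure_of closure_of_minimal subset_antisym)
  moreover have "X interior_of (X closure_of A) - X closure_of (X interior_of A)
      \<subseteq> X interior_of (X frontier_of A)"
  proof (rule interior_of_maximal)
    show "X interior_of (X closure_of A) - X closure_of (X interior_of A) \<subseteq> X frontier_of A"
      unfolding frontier_of_def
      using interior_of_subset[of X "X closure_of A"]
        closure_of_subset[OF interior_of_subset_topspace, of X A] by blast
  qed (simp add: openin_diff)
  ultimately show thesis using that[OF A(1)] by blast
qed

text \<open>The set \<open>ibA\<close> is always regular open. If it is closed, then \<open>bibA = ibA\<close>.\<close>
lemma exists_regular_open:
  assumes "\<not> same_op X wib wbib"
  obtains U where "openin X U" "X interior_of (X closure_of U) = U" "\<not> closedin X U"
proof -
  from assms obtain A where A: "A \<subseteq> topspace X"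
    "X interior_of (X closure_of A) \<noteq> X closure_of (X interior_of (X closure_of A))"
    by (auto simp: same_op_def)
  let ?U = "X interior_of (X closure_of A)"
  have "X interior_of (X closure_of ?U) = ?U"
  proof (rule subset_antisym)
    have "X closure_of ?U \<subseteq> X closure_of A"
      by (meson closedin_closure_of closure_of_minimal interior_of_subset)
    then show "X interior_of (X closure_of ?U) \<subseteq> ?U" by (rule interior_of_mono)
    show "?U \<subseteq> X interior_of (X closure_of ?U)"
      by (simp add: closure_of_subset interior_of_maximal interior_of_subset_topspace)
  qed
  moreover have "\<not> closedin X ?U" using A(2) closure_of_closedin[of X ?U] by auto
  ultimately show thesis by (rule that[OF openin_interior_of])
qed

text \<open>Otherwise every closed set is open, hence \<open>bibA = bA\<close> for all \<open>A\<close>.\<close>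
lemma exists_open_not_closed:
  assumes "\<not> same_op X wb wbib"
  obtains U where "openin X U" "\<not> closedin X U"
proof -
  have "\<exists>U. openin X U \<and> \<not> closedin X U"
  proof (rule ccontr)
    assume none: "\<not> ?thesis"
    have clopen: "openin X C" if "closedin X C" for C
    proof -
      have "closedin X (topspace X - C)" using none that by (auto simp: openin_diff)
      then have "openin X (topspace X - (topspace X - C))" by (auto simp: openin_diff)
      then show ?thesis using closedin_subset[OF that] by (simp add: double_diff)
    qed
    have "X closure_of (X interior_of (X closure_of A)) = X closure_of A" for A
      using clopen[of "X closure_of A"] by (simp add: interior_of_openin)
    then show False using assms by (simp add: same_op_def)
  qed
  then show thesis using that by blast
qed

section \<open>Quotient maps onto the models\<close>

text \<open>A dense open proper subset is the same as an open map onto Sierpinski space. Adding its exterior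
to an open set that is not closed makes it dense without exhausting the space.\<close>

lemma sierpinski_decomposition:
  assumes "\<not> same_op X wb wbib"
  shows "\<exists>Fs. open_decomposition X [[0], [0, 1]] Fs"
proof -
  obtain U where U: "openin X U" "\<not> closedin X U" using exists_open_not_closed assms by blast
  define V where "V = U \<union> (topspace X - X closure_of U)"
  have sub: "U \<subseteq> X closure_of U" "U \<subseteq> topspace X" "V \<subseteq> topspace X"
    using U(1) by (auto simp: V_def openin_subset closure_of_subset)
  have V: "openin X V" unfolding V_def using U(1) by (simp add: openin_Un openin_diff)
  have proper: "topspace X - V \<noteq> {}"
    unfolding V_def using boundary_nonempty[OF U] closure_of_subset_topspace[of X U] by blast
  have "X closure_of U \<union> (topspace X - X closure_of U) \<subseteq> X closure_of V"
    unfolding V_def closure_of_Un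
    using closure_of_subset[of "topspace X - X closure_of U" X] by blast
  then have dense: "X closure_of V = topspace X"
    using closure_of_subset_topspace[of X V] by blast
  then have "V \<noteq> {}" using proper by auto
  have "open_decomposition X [[0], [0, 1]] [V, topspace X - V]"
  proof (rule open_decompositionI)
    show "is_preorder [[0], [0, 1]]" by code_simp
  qed (use V dense sub(3) proper \<open>V \<noteq> {}\<close> in \<open>auto simp: Un_absorb1 closure_of_subset\<close>)
  then show ?thesis by blast
qed

text \<open>For a regular open \<open>U\<close> that is not closed, the boundary adheres to \<open>U\<close> and to the exterior,
which are two different open points of the quotient.\<close>
lemma regular_open_decomposition:
  assumes "\<not> same_op X wib wbib"
  shows "\<exists>Fs. open_decomposition X [[0], [1], [0, 1, 2]] Fs"
proof -
  obtain U where U: "openin X U" "X interior_of (X closure_of U) = U" "\<not> closedin X U"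
    using exists_regular_open assms by blast
  let ?B = "X closure_of U"
  define Fs where "Fs = [U, topspace X - ?B, ?B - U]"
  have sub: "U \<subseteq> ?B" "U \<subseteq> topspace X" "?B \<subseteq> topspace X"
    using U(1) by (simp_all add: openin_subset closure_of_subset closure_of_subset_topspace)
  have ne: "?B - U \<noteq> {}" "topspace X - ?B \<noteq> {}" "U \<noteq> {}"
    using sub regular_open_not_dense[OF U(2,3)] boundary_nonempty[OF U(1,3)] by auto
  have adh: "U \<subseteq> X closure_of U" "topspace X - ?B \<subseteq> X closure_of (topspace X - ?B)"
    "?B - U \<subseteq> X closure_of U" "?B - U \<subseteq> X closure_of (topspace X - ?B)"
    "?B - U \<subseteq> X closure_of (?B - U)"
    using sub closure_exterior_regular[OF U(2)] closure_of_subset[of "?B - U" X]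
      closure_of_subset[of "topspace X - ?B" X] by blast+
  have star: "U \<union> ((topspace X - ?B) \<union> (?B - U)) = topspace X"
    "U \<union> (?B - U) \<union> (topspace X - ?B) = topspace X" using sub by blast+
  have "open_decomposition X [[0], [1], [0, 1, 2]] [U, topspace X - ?B, ?B - U]"
  proof (rule open_decompositionI)
    show "is_preorder [[0], [1], [0, 1, 2]]" by code_simp
    show "list_all2 (\<lambda>F N. \<forall>r\<in>set N. F \<subseteq> X closure_of ([U, topspace X - ?B, ?B - U] ! r))
      [U, topspace X - ?B, ?B - U] [[0], [1], [0, 1, 2]]"
      using adh by simp
  qed (use U sub ne star in \<open>auto simp: openin_diff\<close>)
  then show ?thesis by blast
qed

text \<open>The model is the disjoint sum of an indiscrete pair and the three-point space of
\<open>regular_open_decomposition\<close>. The pair comes from a nonempty clopen \<open>R = ifA\<close>. The clopen hypothesis,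
applied to the subset \<open>U \<inter> R \<inter> A\<close>, makes \<open>U \<inter> R\<close> clopen for every regular open \<open>U\<close>. So
a regular open set that is not closed remains so after \<open>R\<close> has been removed from it, and the other
three cells are found in the complement of \<open>R\<close>.\<close>
lemma KD_decomposition:
  assumes "\<not> same_op X wbi wbib" "\<not> same_op X wib wbib"
    and clopen: "\<And>A. A \<subseteq> topspace X \<Longrightarrow>
      openin X (X interior_of (X frontier_of A)) \<and> closedin X (X interior_of (X frontier_of A))"
  shows "\<exists>Fs. open_decomposition X [[0, 1], [0, 1], [2], [3], [2, 3, 4]] Fs"
proof -
  obtain A where A: "A \<subseteq> topspace X" "X interior_of (X frontier_of A) \<noteq> {}"
    using exists_interior_frontier_nonempty assms(1) by blast
  define R where "R = X interior_of (X frontier_of A)"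
  have R: "openin X R" "closedin X R" "R \<noteq> {}" "R \<subseteq> X frontier_of A"
    using clopen[OF A(1)] A(2) unfolding R_def by (simp_all add: interior_of_subset)
  obtain U where U: "openin X U" "X interior_of (X closure_of U) = U" "\<not> closedin X U"
    using exists_regular_open assms(2) by blast
  have sub: "U \<subseteq> topspace X" "R \<subseteq> topspace X" using U R by (simp_all add: openin_subset)
  define W where "W = topspace X - R"
  have W: "openin X W" "closedin X W" unfolding W_def using R by (simp_all add: openin_diff closedin_diff)
  have UR: "openin X (U \<inter> R)" "U \<inter> R \<subseteq> X frontier_of A" using U R by (auto simp: openin_Int)
  define G where "G = X frontier_of (U \<inter> R \<inter> A)"
  have "U \<inter> R \<subseteq> X closure_of (topspace X - U \<inter> R \<inter> A)"
    using frontier_parts_dense(2)[OF UR] closure_of_mono[of "U \<inter> R - A" "topspace X - U \<inter> R \<inter> A" X] sub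
    by blast
  then have "U \<inter> R \<subseteq> G"
    unfolding G_def frontier_of_closures using frontier_parts_dense(1)[OF UR] sub(1) A(1) by auto
  then have "U \<inter> R \<subseteq> X interior_of G" using UR(1) interior_of_maximal by blast
  moreover have "X interior_of G \<subseteq> U \<inter> R"
  proof -
    have "G \<subseteq> X closure_of (U \<inter> R \<inter> A)" unfolding G_def frontier_of_def by blast
    moreover have "X closure_of (U \<inter> R \<inter> A) \<subseteq> X closure_of U" by (intro closure_of_mono) blast
    moreover have "X closure_of (U \<inter> R \<inter> A) \<subseteq> R" using R(2) by (intro closure_of_minimal) auto
    ultimately show ?thesis
      using interior_of_mono[of G "X closure_of U" X] interior_of_subset[of X G] U(2) by blast
  qed
  ultimately have "X interior_of G = U \<inter> R" by blast
  then have UR_closed: "closedin X (U \<inter> R)"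
    using clopen[of "U \<inter> R \<inter> A"] A(1) unfolding G_def by auto
  define V where "V = U - R"
  let ?B = "X closure_of V"
  have V: "openin X V" unfolding V_def using U(1) R(2) by (rule openin_diff)
  have VW: "V \<subseteq> W" unfolding V_def W_def using sub by blast
  have BW: "?B \<subseteq> W" using W(2) VW by (rule closure_of_minimal[rotated])
  have VB: "V \<subseteq> ?B" "V \<subseteq> topspace X" using V by (simp_all add: closure_of_subset openin_subset)
  have BT: "?B \<subseteq> topspace X" by (rule closure_of_subset_topspace)
  have "X interior_of ?B \<subseteq> U"
    using interior_of_mono[OF closure_of_mono[of V U X], of X] U(2) unfolding V_def by blast
  then have "X interior_of ?B \<subseteq> V"
    using interior_of_subset[of X ?B] BW unfolding V_def W_def by blast
  then have V_regular: "X interior_of ?B = V"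
    using VB(1) V interior_of_maximal by blast
  have V_nonclosed: "\<not> closedin X V"
  proof
    assume "closedin X V"
    then have "closedin X (V \<union> U \<inter> R)" using UR_closed by (rule closedin_Un)
    moreover have "V \<union> U \<inter> R = U" unfolding V_def by blast
    ultimately show False using U(3) by simp
  qed
  have boundary: "?B - V \<noteq> {}" by (rule boundary_nonempty[OF V V_nonclosed])
  have "W \<noteq> ?B"
  proof
    assume "W = ?B"
    then have "V = W" using V_regular W(1) by (simp add: interior_of_openin)
    then show False using V_nonclosed W(2) by simp
  qed
  then have exterior: "W - ?B \<noteq> {}" using BW by blast
  have "V \<noteq> {}" using boundary by auto
  have R_parts: "R \<subseteq> X closure_of (R \<inter> A)" "R \<subseteq> X closure_of (R - A)"
    using frontier_parts_dense[OF R(1) R(4)] by blast+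
  then have R_ne: "R \<inter> A \<noteq> {}" "R - A \<noteq> {}"
    using R(3) R_parts by (metis closure_of_empty subset_empty)+
  \<comment> \<open>The exterior of \<open>V\<close> is the fourth cell together with the closed set \<open>R\<close>, which misses the boundary.\<close>
  have "topspace X - ?B = R \<union> (W - ?B)" using BW sub(2) unfolding W_def by blast
  then have "topspace X - V = R \<union> X closure_of (W - ?B)"
    using closure_exterior_regular[OF V_regular] R(2) by (simp add: closure_of_Un closure_of_closedin)
  then have edge: "?B - V \<subseteq> X closure_of (W - ?B)" using BW BT unfolding W_def by blast
  have W_ext: "openin X (W - ?B)" "W - ?B \<subseteq> topspace X"
    using W(1) openin_subset by (auto simp: openin_diff)
  let ?Fs = "[R \<inter> A, R - A, V, W - ?B, ?B - V]"
  have "open_decomposition X [[0, 1], [0, 1], [2], [3], [2, 3, 4]] ?Fs"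
  proof (rule open_decompositionI)
    show "is_preorder [[0, 1], [0, 1], [2], [3], [2, 3, 4]]" by code_simp
    show "\<Union> (set ?Fs) = topspace X" using VB VW BW sub unfolding W_def by auto
    show "{} \<notin> set ?Fs" using R_ne \<open>V \<noteq> {}\<close> exterior boundary by auto
    show "sorted_wrt (\<lambda>A B. A \<inter> B = {}) ?Fs" using VB VW BW unfolding W_def by auto
    have "R \<inter> A \<union> (R - A) = R" "V \<union> (W - ?B \<union> (?B - V)) = W" using VB VW BW by blast+
    then show "list_all (\<lambda>N. openin X (\<Union>r\<in>set N. ?Fs ! r)) [[0, 1], [0, 1], [2], [3], [2, 3, 4]]"
      using R(1) V W W_ext by simp
    show "list_all2 (\<lambda>F N. \<forall>r\<in>set N. F \<subseteq> X closure_of (?Fs ! r))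
      ?Fs [[0, 1], [0, 1], [2], [3], [2, 3, 4]]"
      using R_parts VB W_ext(2) edge closure_of_subset[OF W_ext(2)]
        closure_of_subset[of "?B - V" X] BT by simp blast
  qed simp
  then show ?thesis by blast
qed

text \<open>A set \<open>R = ifA\<close> is regular open. If it is not closed, it plays the role of \<open>U\<close> in
\<open>regular_open_decomposition\<close>, with the cell \<open>R\<close> split into two dense pieces.\<close>
lemma GE_decomposition:
  assumes A: "A \<subseteq> topspace X" "\<not> closedin X (X interior_of (X frontier_of A))"
  shows "\<exists>Fs. open_decomposition X [[0, 1], [0, 1], [2], [0, 1, 2, 3]] Fs"
proof -
  define R where "R = X interior_of (X frontier_of A)"
  let ?B = "X closure_of R"
  have R: "openin X R" "R \<subseteq> X frontier_of A" unfolding R_def by (simp_all add: interior_of_subset)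
  have sub: "R \<subseteq> ?B" "?B \<subseteq> topspace X"
    using R(1) by (simp_all add: closure_of_subset openin_subset closure_of_subset_topspace)
  have "?B \<subseteq> X frontier_of A"
    using R(2) by (intro closure_of_minimal) (simp_all add: closedin_frontier_of)
  then have "X interior_of ?B \<subseteq> R" unfolding R_def by (rule interior_of_mono)
  then have regular: "X interior_of ?B = R" using sub(1) R(1) interior_of_maximal by blast
  have nonclosed: "\<not> closedin X R" using A(2) unfolding R_def .
  have boundary: "?B - R \<noteq> {}" by (rule boundary_nonempty[OF R(1) nonclosed])
  have exterior: "topspace X - ?B \<noteq> {}"
    using regular_open_not_dense[OF regular nonclosed] sub(2) by blast
  have parts: "R \<subseteq> X closure_of (R \<inter> A)" "R \<subseteq> X closure_of (R - A)"
    using frontier_parts_dense[OF R] by blast+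
  then have B_parts: "?B \<subseteq> X closure_of (R \<inter> A)" "?B \<subseteq> X closure_of (R - A)"
    by (simp_all add: closure_of_minimal)
  have "R \<noteq> {}" using boundary by auto
  then have ne: "R \<inter> A \<noteq> {}" "R - A \<noteq> {}"
    using parts by (metis closure_of_empty subset_empty)+
  let ?Fs = "[R \<inter> A, R - A, topspace X - ?B, ?B - R]"
  have "open_decomposition X [[0, 1], [0, 1], [2], [0, 1, 2, 3]] ?Fs"
  proof (rule open_decompositionI)
    show "is_preorder [[0, 1], [0, 1], [2], [0, 1, 2, 3]]" by code_simp
    show "\<Union> (set ?Fs) = topspace X" using sub by auto
    show "{} \<notin> set ?Fs" using ne exterior boundary by auto
    show "sorted_wrt (\<lambda>A B. A \<inter> B = {}) ?Fs" using sub by auto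
    have "R \<inter> A \<union> (R - A) = R"
      "R \<inter> A \<union> (R - A \<union> (topspace X - ?B \<union> (?B - R))) = topspace X" using sub by blast+
    then show "list_all (\<lambda>N. openin X (\<Union>r\<in>set N. ?Fs ! r)) [[0, 1], [0, 1], [2], [0, 1, 2, 3]]"
      using R(1) by (simp add: openin_diff)
    show "list_all2 (\<lambda>F N. \<forall>r\<in>set N. F \<subseteq> X closure_of (?Fs ! r))
      ?Fs [[0, 1], [0, 1], [2], [0, 1, 2, 3]]"
      using parts B_parts sub closure_exterior_regular[OF regular]
        closure_of_subset[of "topspace X - ?B" X] closure_of_subset[of "?B - R" X] by simp blast
  qed simp
  then show ?thesis by blast
qed

lemma clopen_part_decomposition:
  assumes R: "openin X R" "closedin X R" "R \<noteq> {}" "R \<subseteq> X frontier_of A"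
  shows "R = topspace X \<Longrightarrow> open_decomposition X [[0, 1], [0, 1]] [R \<inter> A, R - A]"
    and "R \<noteq> topspace X \<Longrightarrow>
      open_decomposition X [[0, 1], [0, 1], [2]] [R \<inter> A, R - A, topspace X - R]"
proof -
  have parts: "R \<subseteq> X closure_of (R \<inter> A)" "R \<subseteq> X closure_of (R - A)"
    using frontier_parts_dense[OF R(1,4)] by blast+
  then have ne: "R \<inter> A \<noteq> {}" "R - A \<noteq> {}" using R(3) by (metis closure_of_empty subset_empty)+
  have sub: "R \<subseteq> topspace X" and un: "R \<inter> A \<union> (R - A) = R" using openin_subset[OF R(1)] by auto
  have preorder: "is_preorder [[0, 1], [0, 1]]" "is_preorder [[0, 1], [0, 1], [2]]"
    by code_simp+
  show "open_decomposition X [[0, 1], [0, 1]] [R \<inter> A, R - A]" if "R = topspace X"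
  proof (rule open_decompositionI)
    show "list_all2 (\<lambda>F N. \<forall>r\<in>set N. F \<subseteq> X closure_of ([R \<inter> A, R - A] ! r))
      [R \<inter> A, R - A] [[0, 1], [0, 1]]"
      using parts by simp blast
  qed (use preorder ne un R that in auto)
  show "open_decomposition X [[0, 1], [0, 1], [2]] [R \<inter> A, R - A, topspace X - R]"
    if "R \<noteq> topspace X"
  proof (rule open_decompositionI)
    show "list_all2 (\<lambda>F N. \<forall>r\<in>set N. F \<subseteq> X closure_of ([R \<inter> A, R - A, topspace X - R] ! r))
      [R \<inter> A, R - A, topspace X - R] [[0, 1], [0, 1], [2]]"
      using parts closure_of_subset[of "topspace X - R" X] by simp blast
    show "{} \<notin> set [R \<inter> A, R - A, topspace X - R]" using ne that sub by auto
  qed (use preorder sub un R in \<open>auto simp: openin_diff\<close>)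
qed

lemma partition_clopen:
  assumes "same_op X wib wbib" "same_op X wb wbib"
  shows "openin X S \<longleftrightarrow> closedin X S"
proof -
  have *: "openin X C" if "closedin X C" for C
  proof -
    have "X interior_of (X closure_of C) = X closure_of C"
      using assms closedin_subset[OF that] by (auto simp: same_op_def)
    then show ?thesis using that by (metis closure_of_closedin openin_interior_of)
  qed
  show ?thesis
  proof
    assume S: "openin X S"
    then have "openin X (topspace X - S)" by (intro *) (simp add: openin_closedin_eq)
    then show "closedin X S" using openin_subset[OF S] by (simp add: closedin_def)
  qed (rule *)
qed

text \<open>In a partition space all open sets are clopen, so the open set \<open>ifA\<close>, or its part inside or outside
a given clopen set, can serve as the split part \<open>R\<close>. A space that is not indiscrete has a proper
nonempty open set, and therefore leaves room for a nonempty complement of \<open>R\<close>.\<close>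
lemma partition_decomposition:
  assumes "same_op X wib wbib" "same_op X wb wbib" "\<not> same_op X wbi wbib"
  shows "indiscrete X \<Longrightarrow> \<exists>Fs. open_decomposition X [[0, 1], [0, 1]] Fs"
    and "\<not> indiscrete X \<Longrightarrow> \<exists>Fs. open_decomposition X [[0, 1], [0, 1], [2]] Fs"
proof -
  note clopen = partition_clopen[OF assms(1,2)]
  obtain A where A: "A \<subseteq> topspace X" "X interior_of (X frontier_of A) \<noteq> {}"
    using exists_interior_frontier_nonempty assms(3) by blast
  define R where "R = X interior_of (X frontier_of A)"
  have R: "openin X R" "R \<noteq> {}" "R \<subseteq> X frontier_of A"
    using A(2) unfolding R_def by (simp_all add: interior_of_subset)
  show "\<exists>Fs. open_decomposition X [[0, 1], [0, 1]] Fs" if "indiscrete X"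
    using clopen_part_decomposition(1)[of X R A] R clopen that unfolding indiscrete_def by blast
  show "\<exists>Fs. open_decomposition X [[0, 1], [0, 1], [2]] Fs" if nontrivial: "\<not> indiscrete X"
  proof -
    obtain V where V: "openin X V" "V \<noteq> {}" "V \<noteq> topspace X"
      using nontrivial unfolding indiscrete_def by (metis openin_empty openin_topspace)
    have "\<exists>Q. openin X Q \<and> Q \<noteq> {} \<and> Q \<subseteq> R \<and> Q \<noteq> topspace X"
    proof (cases "R \<inter> V = {}")
      case True
      then show ?thesis using R V(2) openin_subset[OF V(1)] by (intro exI[of _ R]) blast
    next
      case False
      then show ?thesis using R(1) V openin_subset[OF V(1)]
        by (intro exI[of _ "R \<inter> V"]) (auto simp: openin_Int)
    qed
    then show ?thesis using clopen_part_decomposition(2)[of X _ A] R(3) clopen by (meson subset_trans)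
  qed
qed

text \<open>The equation \<open>b = bi\<close> at a singleton \<open>{x}\<close> shows that its interior is not empty, so the
singleton is open.\<close>
lemma discrete_decomposition:
  assumes "same_op X wbi wbib" "same_op X wib wbib" "same_op X wb wbib"
    and xy: "x \<in> topspace X" "y \<in> topspace X" "x \<noteq> y"
  shows "\<exists>Fs. open_decomposition X [[0], [1]] Fs"
proof -
  note clopen = partition_clopen[OF assms(2,3)]
  have "X closure_of {x} = X closure_of (X interior_of {x})"
    using assms(1,3) xy by (auto simp: same_op_def)
  then have "X interior_of {x} \<noteq> {}" using closure_of_subset[of "{x}" X] xy by auto
  then have "X interior_of {x} = {x}" using interior_of_subset[of X "{x}"] by blast
  then have x: "openin X {x}" by (metis openin_interior_of)
  have "openin X (topspace X - {x})"
    by (rule openin_diff[OF openin_topspace]) (use x clopen in blast)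
  have "open_decomposition X [[0], [1]] [{x}, topspace X - {x}]"
  proof (rule open_decompositionI)
    show "is_preorder [[0], [1]]" by code_simp
  qed (use x \<open>openin X (topspace X - {x})\<close> xy closure_of_subset[of "{x}" X]
      closure_of_subset[of "topspace X - {x}" X] in auto)
  then show ?thesis by blast
qed

section \<open>The finite spaces themselves\<close>

definition finite_space :: "nat list list \<Rightarrow> nat topology" where
  "finite_space N = topology (\<lambda>U. U \<subseteq> {..<length N} \<and> (\<forall>p\<in>U. set (N ! p) \<subseteq> U))"

lemma openin_finite_space:
  "openin (finite_space N) U \<longleftrightarrow> U \<subseteq> {..<length N} \<and> (\<forall>p\<in>U. set (N ! p) \<subseteq> U)"
proof -
  have "istopology (\<lambda>U. U \<subseteq> {..<length N} \<and> (\<forall>p\<in>U. set (N ! p) \<subseteq> U))"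
    unfolding istopology_def by (intro conjI allI impI; blast)
  then show ?thesis by (simp add: finite_space_def)
qed

lemma topspace_finite_space:
  assumes "is_preorder N"
  shows "topspace (finite_space N) = {..<length N}"
proof -
  have "openin (finite_space N) {..<length N}"
    using assms unfolding openin_finite_space is_preorder_def by auto
  then show ?thesis
    by (metis openin_finite_space openin_subset openin_topspace subset_antisym)
qed

lemma finite_space_decomposition:
  assumes "is_preorder N"
  shows "open_decomposition (finite_space N) N (map (\<lambda>p. {p}) [0..<length N])"
proof
  fix p q assume p: "p < length N" and q: "q \<in> set (N ! p)"
  then have "q < length N" using assms unfolding is_preorder_def by simp
  then show "map (\<lambda>p. {p}) [0..<length N] ! p
      \<subseteq> finite_space N closure_of (map (\<lambda>p. {p}) [0..<length N] ! q)"
    using p q by (auto simp: in_closure_of topspace_finite_space[OF assms] openin_finite_space)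
next
  fix p assume p: "p < length N"
  then have "set (N ! p) \<subseteq> {..<length N}" "\<forall>q\<in>set (N ! p). set (N ! q) \<subseteq> set (N ! p)"
    using assms unfolding is_preorder_def by auto
  moreover from this have "(\<Union>r\<in>set (N ! p). map (\<lambda>p. {p}) [0..<length N] ! r) = set (N ! p)"
    by (auto simp: subset_iff)
  ultimately show "openin (finite_space N) (\<Union>r\<in>set (N ! p). map (\<lambda>p. {p}) [0..<length N] ! r)"
    by (simp add: openin_finite_space)
qed (use assms in \<open>auto simp: topspace_finite_space is_preorder_def\<close>)

locale finite_preorder =
  fixes N :: "nat list list"
  assumes preorder: "is_preorder N"

sublocale finite_preorder \<subseteq> open_decomposition "finite_space N" N "map (\<lambda>p. {p}) [0..<length N]"
  by (rule finite_space_decomposition[OF preorder])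

definition subset_codes :: "nat list list \<Rightarrow> bool list list" where
  "subset_codes N = List.n_lists (length N) [False, True]"

lemma subset_codes_iff: "bs \<in> set (subset_codes N) \<longleftrightarrow> length bs = length N"
  by (auto simp: subset_codes_def set_n_lists)

definition code_of :: "nat list list \<Rightarrow> nat list \<Rightarrow> bool list" where
  "code_of N A = map (\<lambda>p. p \<in> set A) [0..<length N]"

context finite_preorder
begin

lemma subset_is_region:
  assumes "A \<subseteq> topspace (finite_space N)"
  obtains bs where "bs \<in> set (subset_codes N)" "A = region bs"
proof
  let ?bs = "map (\<lambda>p. p \<in> A) [0..<length N]"
  show "?bs \<in> set (subset_codes N)" by (simp add: subset_codes_iff)
  show "A = region ?bs" by (rule region_eqI[OF assms]) auto
qed

lemma same_op_iff:
  "same_op (finite_space N) v w \<longleftrightarrow>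
     (\<forall>bs\<in>set (subset_codes N). model_word N v bs = model_word N w bs)"
proof -
  have "(\<forall>A. A \<subseteq> topspace (finite_space N) \<longrightarrow> P A) \<longleftrightarrow> (\<forall>bs\<in>set (subset_codes N). P (region bs))" for P
    using subset_is_region region_subset by metis
  then show ?thesis
    unfolding same_op_def by (simp add: word_op_region_eq_iff subset_codes_iff)
qed

text \<open>Sets \<open>ifA\<close> are always open, so they are clopen exactly if \<open>b\<close> fixes them.\<close>
lemma KD_space_iff:
  "KD_space (finite_space N) \<longleftrightarrow>
    kuratowski_space (finite_space N) \<and> same_op (finite_space N) wbif wif"
  unfolding KD_space_def same_op_def by (simp add: closure_of_eq)

end

definition model_type :: "nat list list \<Rightarrow> word list" where
  "model_type N = filter (\<lambda>w. list_all (\<lambda>bs. model_word N w bs = model_word N wbib bs) (subset_codes N))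
     [wib, wbi, wb]"

lemma (in finite_preorder) type_set_finite_space: "type_set (finite_space N) = set (model_type N)"
  by (simp only: type_set_def model_type_def same_op_iff list_all_iff set_filter list.set)

text \<open>The model for ED is not an ED space: it is only a common quotient of all ED spaces.\<close>
primrec model :: "space_type \<Rightarrow> nat list list" where
  "model Discrete_gt1 = [[0], [1]]"
| "model Indiscrete_partition = [[0, 1], [0, 1]]"
| "model Nonindiscrete_partition = [[0, 1], [0, 1], [2]]"
| "model EO = [[0], [0, 1]]"
| "model ED = [[0], [0, 1]]"
| "model OU = [[0], [1], [0, 1, 2]]"
| "model KD = [[0, 1], [0, 1], [2], [3], [2, 3, 4]]"
| "model GE = [[0, 1], [0, 1], [2], [0, 1, 2, 3]]"

lemma preorder_model: "is_preorder (model t)"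
  by (cases t) (simp_all, code_simp+)

lemma model_decomposition:
  assumes "has_type X t"
  shows "\<exists>Fs. open_decomposition X (model t) Fs"
proof -
  have same: "same_op X w wbib \<longleftrightarrow> w \<in> type_set X" if "w \<in> {wib, wbi, wb}" for w
    using that by (simp add: type_set_def)
  note defs = discrete_space_def partition_space_def EO_space_def ED_space_def OU_space_def
    kuratowski_space_def
  show ?thesis
  proof (cases t)
    case Discrete_gt1
    then obtain x y where "type_set X = {wib, wbi, wb}" "x \<in> topspace X" "y \<in> topspace X" "x \<noteq> y"
      using assms by (auto simp: defs)
    then show ?thesis using discrete_decomposition[of X x y] Discrete_gt1 by (simp add: same)
  next
    case Indiscrete_partition
    then show ?thesis using assms partition_decomposition(1)[of X] by (simp add: same defs)
  next
    case Nonindiscrete_partition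
    then show ?thesis using assms partition_decomposition(2)[of X] by (simp add: same defs)
  next
    case EO
    then show ?thesis using assms sierpinski_decomposition[of X] by (simp add: same defs)
  next
    case ED
    then show ?thesis using assms sierpinski_decomposition[of X] by (simp add: same defs)
  next
    case OU
    then show ?thesis using assms regular_open_decomposition[of X] by (simp add: same defs)
  next
    case KD
    then show ?thesis using assms KD_decomposition[of X] by (simp add: same defs KD_space_def)
  next
    case GE
    then obtain A where "A \<subseteq> topspace X" "\<not> closedin X (X interior_of (X frontier_of A))"
      using assms by (auto simp: GE_space_def KD_space_def)
    then show ?thesis using GE_decomposition[of A X] GE by simp
  qed
qed

lemma model_types:
  "set (model_type [[0], [1]]) = {wib, wbi, wb}"
  "set (model_type [[0, 1], [0, 1]]) = {wib, wb}"
  "set (model_type [[0, 1], [0, 1], [2]]) = {wib, wb}"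
  "set (model_type [[0], [0, 1]]) = {wib, wbi}"
  "set (model_type [[0], [1], [0, 1, 2]]) = {wbi}"
  "set (model_type [[0, 1], [0, 1], [2], [3], [2, 3, 4]]) = {}"
  "set (model_type [[0, 1], [0, 1], [2], [0, 1, 2, 3]]) = {}"
  "set (model_type [[0, 1], [0, 1], [0, 1, 2]]) = {wib}"
  "set (model_type [[0, 1], [0, 1], [0, 1, 2], [3]]) = {wib}"
  by code_simp+

lemma model_has_type:
  assumes "t \<noteq> ED"
  shows "has_type (finite_space (model t)) t"
proof -
  interpret finite_preorder "model t" by unfold_locales (rule preorder_model)
  note top = topspace_finite_space[OF preorder_model[of t]]
  note T = type_set_finite_space
  note defs = discrete_space_def partition_space_def EO_space_def ED_space_def OU_space_def
    kuratowski_space_def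
  have if_closed: "list_all (\<lambda>bs. model_word (model KD) wbif bs = model_word (model KD) wif bs)
      (subset_codes (model KD))"
    and if_not_closed: "\<not> list_all (\<lambda>bs. model_word (model GE) wbif bs = model_word (model GE) wif bs)
      (subset_codes (model GE))"
    by code_simp+
  \<comment> \<open>The entries of the models stay literal below, in the form in which \<open>model_types\<close> lists them: hence no rewriting of \<open>1\<close> to \<open>Suc 0\<close>.\<close>
  note simps = defs model_types lessThan_Suc
  show ?thesis
  proof (cases t)
    case Discrete_gt1
    then show ?thesis using top T by (auto simp: simps simp del: One_nat_def)
  next
    case Indiscrete_partition
    have "topspace (finite_space [[0, 1], [0, 1]]) = {..<2}"
      using top Indiscrete_partition by (simp del: One_nat_def)
    moreover have "set ([[0, 1], [0, 1]] ! p) = {..<2::nat}" if "p < 2" for p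
      using that by (auto simp: less_2_cases_iff)
    then have "openin (finite_space [[0, 1], [0, 1]]) U \<longleftrightarrow> U \<subseteq> {..<2} \<and> (\<forall>p\<in>U. {..<2} \<subseteq> U)" for U
      unfolding openin_finite_space by (auto simp: subset_iff numeral_2_eq_2)
    then have "openin (finite_space [[0, 1], [0, 1]]) U \<longleftrightarrow> U = {} \<or> U = {..<2}" for U
      by (metis all_not_in_conv empty_subsetI subset_antisym subset_refl)
    ultimately have "indiscrete (finite_space [[0, 1], [0, 1]])"
      by (simp add: indiscrete_def)
    with Indiscrete_partition show ?thesis using top T by (auto simp: simps simp del: One_nat_def)
  next
    case Nonindiscrete_partition
    have "openin (finite_space [[0, 1], [0, 1], [2]]) {2}"
      by (simp add: openin_finite_space)
    moreover have "{2} \<noteq> {..<3::nat}"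
      by (metis lessThan_iff singletonD zero_less_numeral zero_neq_numeral)
    moreover have "topspace (finite_space [[0, 1], [0, 1], [2]]) = {..<3}"
      using top Nonindiscrete_partition by (simp del: One_nat_def)
    ultimately have "\<not> indiscrete (finite_space [[0, 1], [0, 1], [2]])"
      unfolding indiscrete_def by auto
    with Nonindiscrete_partition show ?thesis using top T
      by (auto simp: simps simp del: One_nat_def)
  next
    case KD
    then have "kuratowski_space (finite_space (model t))"
      using top T by (auto simp: simps simp del: One_nat_def)
    then show ?thesis using KD KD_space_iff same_op_iff[of wbif wif] if_closed
      by (simp only: has_type.simps list_all_iff)
  next
    case GE
    then have "kuratowski_space (finite_space (model t))"
      using top T by (auto simp: simps simp del: One_nat_def)
    then show ?thesis using GE KD_space_iff same_op_iff[of wbif wif] if_not_closed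
      by (simp only: has_type.simps GE_space_def list_all_iff simp_thms)
  qed (use assms top T in \<open>auto simp: simps simp del: One_nat_def\<close>)
qed

section \<open>The psi-numbers of the subsets of the models\<close>

text \<open>The subsets of the model, as lists of points, that have a given \<open>\<psi>\<close>-number. The two trivial
subsets are left out.\<close>

primrec psi_table :: "space_type \<Rightarrow> (nat \<times> nat list list) list" where
  "psi_table Discrete_gt1 = [(68, [[0], [1]])]"
| "psi_table Indiscrete_partition = [(61, [[0], [1]])]"
| "psi_table Nonindiscrete_partition =
    [(59, [[0, 2], [1, 2]]), (60, [[0], [1]]), (68, [[2], [0, 1]])]"
| "psi_table EO = [(65, [[0]]), (67, [[1]])]"
| "psi_table ED = [(65, [[0]]), (67, [[1]])]"
| "psi_table OU = [(62, [[0, 2], [1, 2]]), (63, [[0], [1]]), (65, [[0, 1]]), (67, [[2]])]"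
| "psi_table KD =
    [(31, [[0, 2], [0, 3], [1, 2], [1, 3], [0, 2, 4], [0, 3, 4], [1, 2, 4], [1, 3, 4]]),
     (46, [[0, 2, 3], [1, 2, 3]]), (48, [[0, 4], [1, 4]]),
     (59, [[0, 2, 3, 4], [1, 2, 3, 4]]), (60, [[0], [1]]),
     (62, [[2, 4], [3, 4], [0, 1, 2, 4], [0, 1, 3, 4]]),
     (63, [[2], [3], [0, 1, 2], [0, 1, 3]]),
     (64, [[2, 3]]), (65, [[0, 1, 2, 3]]), (66, [[0, 1, 4]]), (67, [[4]]),
     (68, [[0, 1], [2, 3, 4]])]"
| "psi_table GE =
    [(42, [[0, 2], [1, 2], [0, 2, 3], [1, 2, 3]]), (44, [[0], [1], [0, 3], [1, 3]]),
     (62, [[2, 3], [0, 1, 3]]), (63, [[2], [0, 1]]), (65, [[0, 1, 2]]), (67, [[3]])]"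

definition table_correct :: "nat list list \<Rightarrow> (nat \<times> nat list list) list \<Rightarrow> bool" where
  "table_correct N tab \<longleftrightarrow>
     list_all (\<lambda>(n, As). list_all (\<lambda>A. collapse_test N n (code_of N A)) As) tab \<and>
     list_all (\<lambda>bs. bs \<in> set (map (code_of N) (concat (map snd tab))) \<or>
         list_all Not bs \<or> list_all id bs) (subset_codes N)"

lemma psi_tables_correct:
  "table_correct (model Discrete_gt1) (psi_table Discrete_gt1)"
  "table_correct (model Indiscrete_partition) (psi_table Indiscrete_partition)"
  "table_correct (model Nonindiscrete_partition) (psi_table Nonindiscrete_partition)"
  "table_correct (model EO) (psi_table EO)"
  "table_correct (model ED) (psi_table ED)"
  "table_correct (model OU) (psi_table OU)"
  "table_correct (model GE) (psi_table GE)"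
  by code_simp+

lemma psi_table_KD_correct: "table_correct (model KD) (psi_table KD)"
  by code_simp

lemma ED_table_correct: "table_correct [[0, 1], [0, 1], [0, 1, 2]]
  [(61, [[0], [1], [0, 2], [1, 2]]), (65, [[0, 1]]), (67, [[2]])]"
  by code_simp

lemma table_correct_psi_table: "table_correct (model t) (psi_table t)"
  using psi_tables_correct psi_table_KD_correct by (cases t) (simp_all only:)

lemma psi_list_table: "psi_list t = fst ` set (psi_table t)"
  by (cases t) auto

lemma psi_table_entry: "(n, As) \<in> set (psi_table t) \<Longrightarrow> n \<in> psi_numbers \<and> As \<noteq> []"
  by (cases t) (auto simp: psi_numbers_def)

section \<open>Realisation and sharpness\<close>

lemma psi_realised:
  assumes "has_type X t" "n \<in> psi_list t"
  shows "\<exists>A. A \<subseteq> topspace X \<and> has_psi X A n"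
proof -
  obtain Fs where "open_decomposition X (model t) Fs" using model_decomposition[OF assms(1)] by blast
  then interpret open_decomposition X "model t" Fs .
  obtain As where As: "(n, As) \<in> set (psi_table t)" using assms(2) by (auto simp: psi_list_table)
  then obtain A where "A \<in> set As" and n: "n \<in> psi_numbers"
    using psi_table_entry list.set_intros(1) by (metis neq_Nil_conv)
  then have "collapse_test (model t) n (code_of (model t) A)"
    using table_correct_psi_table[of t] As by (auto simp: table_correct_def list_all_iff)
  then have "has_psi X (region (code_of (model t) A)) n"
    by (intro region_has_psi n) (simp_all add: code_of_def)
  then show ?thesis using region_subset by blast
qed

lemma (in finite_preorder) only_tabulated_collapses:
  assumes tab: "table_correct N tab" "fst ` set tab \<subseteq> psi_numbers"
    and A: "A \<subseteq> topspace (finite_space N)" "satisfies (finite_space N) A C" and C: "is_collapse C"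
  shows "C \<in> numbered_collapse ` fst ` set tab \<or> A = {} \<or> A = topspace (finite_space N)"
proof -
  obtain bs where bs: "bs \<in> set (subset_codes N)" "A = region bs"
    using subset_is_region[OF A(1)] by blast
  then have len: "length bs = length N" by (simp add: subset_codes_iff)
  consider (tab) "bs \<in> set (map (code_of N) (concat (map snd tab)))"
    | (empty) "list_all Not bs" | (full) "list_all id bs"
    using assms(1) bs(1) unfolding table_correct_def list_all_iff by blast
  then show ?thesis
  proof cases
    case tab
    then obtain n As B where B: "(n, As) \<in> set tab" "B \<in> set As" "bs = code_of N B" by auto
    then have n: "n \<in> psi_numbers" using assms(2) by force
    have "collapse_test N n bs"
      using assms(1) B unfolding table_correct_def by (auto simp: list_all_iff)
    then have "satisfies (finite_space N) A (numbered_collapse n)"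
      using region_has_psi[OF n _ len] bs(2) by (simp add: has_psi_def)
    then have "C = numbered_collapse n"
      using satisfied_collapse_unique[OF C numbered_is_collapse[OF n] A(2)] by blast
    then show ?thesis using B(1) by force
  next
    case empty
    then have "A = {}" unfolding bs(2) region_def by (auto simp: list_all_length len)
    then show ?thesis by blast
  next
    case full
    then have "topspace (finite_space N) = region bs"
      by (intro region_eqI) (auto simp: list_all_length len topspace_finite_space[OF preorder])
    then show ?thesis using bs(2) by blast
  qed
qed

text \<open>The collapses of \<open>\<emptyset>\<close> and of the whole space do not depend on the space, so triviality can be
transferred from spaces over an arbitrary type to spaces of natural numbers.\<close>
lemma nontrivial_collapse:
  fixes Y :: "nat topology"
  assumes "is_collapse C" "\<not> trivial_collapse TYPE('b) C" "topspace Y \<noteq> {}"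
  shows "\<not> satisfies Y {} C" "\<not> satisfies Y (topspace Y) C"
proof -
  let ?X = "discrete_topology (UNIV :: 'b set)"
  have X: "topspace ?X \<noteq> {}" by simp
  show "\<not> satisfies Y {} C" "\<not> satisfies Y (topspace Y) C"
    using assms(1,2) X trivial_collapse_independent[OF X assms(3), of C]
    unfolding trivial_collapse_def by blast+
qed

lemma ED_spaces:
  "has_type (finite_space [[0, 1], [0, 1], [0, 1, 2]]) ED" (is "has_type (finite_space ?M) _")
  "has_type (finite_space [[0, 1], [0, 1], [0, 1, 2], [3]]) ED" (is "has_type (finite_space ?N) _")
proof -
  have M: "is_preorder ?M" and N: "is_preorder ?N" by code_simp+
  show "has_type (finite_space ?M) ED"
    using finite_preorder.type_set_finite_space[of ?M] M topspace_finite_space[OF M]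
    by (simp add: finite_preorder_def ED_space_def model_types lessThan_Suc del: One_nat_def)
  show "has_type (finite_space ?N) ED"
    using finite_preorder.type_set_finite_space[of ?N] N topspace_finite_space[OF N]
    by (simp add: finite_preorder_def ED_space_def model_types lessThan_Suc del: One_nat_def)
qed

text \<open>The collapse \<open>61\<close> requires \<open>f = 1\<close>, but no boundary contains the isolated clopen point \<open>3\<close> of the
second space. All other collapses outside the list are excluded by the first space.\<close>
lemma ED_sharp:
  assumes C: "is_collapse C" "C \<notin> numbered_collapse ` psi_list ED"
    and nontrivial: "\<And>Y :: nat topology. topspace Y \<noteq> {} \<Longrightarrow>
      \<not> satisfies Y {} C \<and> \<not> satisfies Y (topspace Y) C"
  shows "\<exists>Y :: nat topology. has_type Y ED \<and> (\<forall>A. A \<subseteq> topspace Y \<longrightarrow> \<not> satisfies Y A C)"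
proof (cases "C = numbered_collapse 61")
  case True
  let ?N = "[[0, 1], [0, 1], [0, 1, 2], [3::nat]]"
  have "is_preorder ?N" by code_simp
  then interpret finite_preorder ?N by unfold_locales
  have proper: "list_all (\<lambda>bs. model_word ?N wf bs \<noteq> model_word ?N w1 bs) (subset_codes ?N)"
    by code_simp
  have "\<not> satisfies (finite_space ?N) A C" if A: "A \<subseteq> topspace (finite_space ?N)" for A
  proof
    assume "satisfies (finite_space ?N) A C"
    moreover have "[wf, w1] \<in> set (equations 61)" by (simp add: equations_def)
    then have "gen_equiv (equations 61) wf w1" by (rule gen_base) simp_all
    then have "{wf, w1} \<in> C" unfolding True numbered_collapse_def by (simp add: generated_collapse_iff)
    moreover have "wf \<in> KF" "w1 \<in> KF" by (simp_all add: KF_def F0_def)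
    ultimately have "word_op (finite_space ?N) wf A = word_op (finite_space ?N) w1 A"
      unfolding satisfies_def by blast
    moreover obtain bs where "bs \<in> set (subset_codes ?N)" "A = region bs"
      using subset_is_region[OF A] by blast
    ultimately have "bs \<in> set (subset_codes ?N)" "model_word ?N wf bs = model_word ?N w1 bs"
      using word_op_region_eq_iff[of bs wf w1] unfolding subset_codes_iff by blast+
    then show False using proper unfolding list_all_iff by blast
  qed
  then show ?thesis using ED_spaces(2) by blast
next
  case False
  let ?M = "[[0, 1], [0, 1], [0, 1, 2::nat]]"
  have "is_preorder ?M" by code_simp
  then interpret finite_preorder ?M by unfold_locales
  have "\<not> satisfies (finite_space ?M) A C" if "A \<subseteq> topspace (finite_space ?M)" for A
    using only_tabulated_collapses[OF ED_table_correct _ that _ C(1)] C(2) False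
      nontrivial[of "finite_space ?M"] ED_spaces(1)
    by (auto simp: psi_numbers_def ED_space_def)
  then show ?thesis using ED_spaces(1) by blast
qed

lemma model_sharp:
  assumes t: "t \<noteq> ED" and C: "is_collapse C" "C \<notin> numbered_collapse ` psi_list t"
    and nontrivial: "\<And>Y :: nat topology. topspace Y \<noteq> {} \<Longrightarrow>
      \<not> satisfies Y {} C \<and> \<not> satisfies Y (topspace Y) C"
  shows "\<exists>Y :: nat topology. has_type Y t \<and> (\<forall>A. A \<subseteq> topspace Y \<longrightarrow> \<not> satisfies Y A C)"
proof -
  interpret finite_preorder "model t" by unfold_locales (rule preorder_model)
  have "fst ` set (psi_table t) \<subseteq> psi_numbers" using psi_table_entry by force
  moreover have "0 < length (model t)" by (cases t) simp_all
  then have "topspace (finite_space (model t)) \<noteq> {}"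
    using topspace_finite_space[OF preorder_model[of t]] by (metis emptyE lessThan_iff)
  ultimately have "\<not> satisfies (finite_space (model t)) A C"
    if "A \<subseteq> topspace (finite_space (model t))" for A
    using only_tabulated_collapses[OF table_correct_psi_table _ that _ C(1)] C(2) nontrivial
    unfolding psi_list_table by blast
  then show ?thesis using model_has_type[OF t] by blast
qed

theorem theorem9:
  shows "(\<forall>t. \<forall>n \<in> psi_list t. \<forall>X :: 'a topology.
            has_type X t \<longrightarrow> (\<exists>A. A \<subseteq> topspace X \<and> has_psi X A n)) \<and>
         (\<forall>t C. local_collapse TYPE('b) C \<and> C \<notin> numbered_collapse ` psi_list t \<and>
            \<not> trivial_collapse TYPE('b) C \<longrightarrow>
            (\<exists>Y :: nat topology. has_type Y t \<and>
               (\<forall>A. A \<subseteq> topspace Y \<longrightarrow> \<not> satisfies Y A C)))"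
proof (intro conjI allI ballI impI)
  fix t n and X :: "'a topology"
  assume "n \<in> psi_list t" "has_type X t"
  then show "\<exists>A. A \<subseteq> topspace X \<and> has_psi X A n" using psi_realised by blast
next
  fix t C
  assume "local_collapse TYPE('b) C \<and> C \<notin> numbered_collapse ` psi_list t \<and> \<not> trivial_collapse TYPE('b) C"
  then have C: "is_collapse C" "C \<notin> numbered_collapse ` psi_list t" "\<not> trivial_collapse TYPE('b) C"
    by (simp_all add: local_collapse_def)
  then show "\<exists>Y :: nat topology. has_type Y t \<and> (\<forall>A. A \<subseteq> topspace Y \<longrightarrow> \<not> satisfies Y A C)"
    using nontrivial_collapse[OF C(1,3)] ED_sharp[OF C(1)] model_sharp[OF _ C(1,2)]
    by (cases "t = ED") blast+
qed

end
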